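(* Let $k,n$ be integers with $1\le k\le n$. Then for every integer $i$ with $0\le i\le n-k$, $$\sum_{l=i}^{n-k}(-1)^{l-i}\binom{n-k}{l}\frac{(k+1/2)_l}{(2k)_l}\binom{l}{i}=2^{2k-1}\binom{n+k-1}{k-1}^{-1}\binom{n-1}{k-1}^{-1}\binom{2n-2i-2}{2k-2}\binom{n-1}{i}r_{n,k+i},$$ and for every integer $j$ with $0\le j\le n-k$, $$\sum_{l=j}^{n-k}\binom{2n-2l-2}{2k-2}\binom{n-1}{l}\binom{l}{j}r_{n,k+l}=2^{1-2k}\binom{n+k-1}{k-1}\binom{n-1}{k-1}\binom{n-k}{j}\frac{(k+1/2)_j}{(2k)_j}.$$
   Context: Notation: $(y)_0:=1$, $(y)_s:=y(y+1)\cdots(y+s-1)$ for $s\ge1$; for $0\le j\le n$, $r_{n,j}:=\binom{n}{j}^{-1}4^{-n}\binom{2j}{j}\binom{2n-2j}{n-j}$. *)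

theory Defs
  imports Complex_Main
begin

(* Only meaningful for j <= n: beyond that the natural-number subtraction truncates. *)
definition r_coeff :: "nat \<Rightarrow> nat \<Rightarrow> real" where
  "r_coeff n j = inverse (real (n choose j)) * 4 powi (- int n)
     * real ((2 * j) choose j) * real ((2 * n - 2 * j) choose (n - j))"

end

theory Submission
  imports Defs "HOL-Computational_Algebra.Formal_Power_Series"
begin

text \<open>
  Put \<open>m = n - k\<close>, \<open>a = k + 1/2\<close>, \<open>c = 2 k\<close>. The two identities form a binomial inverse pair: the
  first expresses a sequence \<open>g\<close> as the inverse binomial transform of
  \<open>f l = (m choose l) (a)\<^sub>l / (c)\<^sub>l\<close>, and the second recovers \<open>f\<close> from \<open>g\<close>, the prefactor of the
  first having moved to the other side. So only the first needs a computation
  (\<open>binomial_inversion\<close> supplies the second).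

  Trinomial revision turns the first sum into a terminating Gauss series at 1, which the
  Chu--Vandermonde identity evaluates to the product
  \<open>(m choose i) (a)\<^sub>i (c - a)\<^sub>m\<^sub>-\<^sub>i / (c)\<^sub>m\<close> (\<open>alternating_binomial_transform_pochhammer\<close>).
  This product agrees with the claimed right-hand side because a central binomial
  coefficient \<open>(2 j) choose j\<close> is \<open>4 ^ j (1/2)\<^sub>j / j!\<close>; in particular \<open>r_coeff n j = (1/2)\<^sub>j (1/2)\<^sub>n\<^sub>-\<^sub>j / n!\<close>
  (\<open>r_coeff_eq_pochhammer\<close>), while \<open>(a)\<^sub>i\<close> and \<open>(c - a)\<^sub>m\<^sub>-\<^sub>i\<close> are quotients of such rising
  factorials.
\<close>

section \<open>Binomial inversion\<close>

text \<open>By trinomial revision the sum is \<open>l choose j\<close> times the binomial expansion of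
  \<open>(1 - 1) ^ (l - j)\<close>.\<close>
lemma sum_alternating_binomial_orthogonal:
  assumes "j \<le> l"
  shows "(\<Sum>i = j..l. (-1) ^ (l - i) * of_nat (l choose i) * of_nat (i choose j))
    = (if l = j then 1 else 0 :: 'a :: comm_ring_1)"
proof -
  have "(\<Sum>i = j..l. (-1) ^ (l - i) * of_nat (l choose i) * of_nat (i choose j))
      = (\<Sum>s\<le>l - j. of_nat (l choose j) * ((-1) ^ s * of_nat ((l - j) choose s)) :: 'a)"
  proof (rule sum.reindex_bij_witness[of _ "\<lambda>s. l - s" "\<lambda>i. l - i"])
    fix i assume i: "i \<in> {j..l}"
    have "(l choose i) * (i choose j) = (l choose j) * ((l - j) choose (i - j))"
      using i by (intro choose_mult) auto
    also have "(l - j) choose (i - j) = (l - j) choose (l - i)"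
      using i binomial_symmetric[of "i - j" "l - j"] by (simp add: diff_le_mono)
    finally have "of_nat (l choose i) * of_nat (i choose j)
        = (of_nat (l choose j) * of_nat ((l - j) choose (l - i)) :: 'a)"
      by (metis of_nat_mult)
    then show "of_nat (l choose j) * ((-1) ^ (l - i) * of_nat ((l - j) choose (l - i)))
        = ((-1) ^ (l - i) * of_nat (l choose i) * of_nat (i choose j) :: 'a)"
      by (metis mult.assoc mult.left_commute)
  qed (use assms in auto)
  also have "\<dots> = (if l = j then 1 else 0)"
    using assms choose_alternating_sum[of "l - j", where ?'a = 'a]
    by (auto simp flip: sum_distrib_left)
  finally show ?thesis .
qed

lemma binomial_inversion:
  fixes f g :: "nat \<Rightarrow> 'a :: comm_ring_1"
  assumes g: "\<And>i. i \<le> m \<Longrightarrow> g i = (\<Sum>l = i..m. (-1) ^ (l - i) * f l * of_nat (l choose i))"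
    and j: "j \<le> m"
  shows "(\<Sum>i = j..m. g i * of_nat (i choose j)) = f j"
proof -
  have "(\<Sum>i = j..m. g i * of_nat (i choose j))
      = (\<Sum>i = j..m. \<Sum>l = i..m. (-1) ^ (l - i) * f l * of_nat (l choose i) * of_nat (i choose j))"
    by (intro sum.cong) (simp_all add: g sum_distrib_right)
  also have "\<dots> = (\<Sum>l = j..m. \<Sum>i = j..l.
      (-1) ^ (l - i) * f l * of_nat (l choose i) * of_nat (i choose j))"
    unfolding sum.Sigma[OF finite_atLeastAtMost ballI, OF finite_atLeastAtMost]
    by (rule sum.reindex_bij_witness[of _ "\<lambda>(l, i). (i, l)" "\<lambda>(i, l). (l, i)"]) auto
  also have "\<dots> = (\<Sum>l = j..m. f l *
      (\<Sum>i = j..l. (-1) ^ (l - i) * of_nat (l choose i) * of_nat (i choose j)))"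
    by (simp add: sum_distrib_left mult_ac)
  also have "\<dots> = (\<Sum>l = j..m. if l = j then f l else 0)"
    by (intro sum.cong) (auto simp: sum_alternating_binomial_orthogonal)
  also have "\<dots> = f j"
    using j by simp
  finally show ?thesis .
qed

section \<open>Alternating binomial sums of Pochhammer quotients\<close>

text \<open>This is the Chu--Vandermonde identity, with \<open>(-N)\<^sub>s / s!\<close> written as a signed binomial
  coefficient.\<close>
lemma sum_alternating_binomial_pochhammer_quotient:
  fixes a c :: real
  assumes "c > 0"
  shows "(\<Sum>s\<le>N. (-1) ^ s * real (N choose s) * (pochhammer a s / pochhammer c s))
    = pochhammer (c - a) N / pochhammer c N"
proof -
  have "(-1) ^ s * real (N choose s) = pochhammer (- real N) s / fact s" for s
    unfolding binomial_gbinomial gbinomial_pochhammer by (simp add: power_mult_distrib [symmetric])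
  then have "(\<Sum>s\<le>N. (-1) ^ s * real (N choose s) * (pochhammer a s / pochhammer c s))
      = (\<Sum>s = 0..N. (pochhammer a s * pochhammer (- real N) s) / (fact s * pochhammer c s))"
    by (simp add: atLeast0AtMost mult_ac)
  also have "\<dots> = pochhammer (c - a) N / pochhammer c N"
    using Vandermonde_pochhammer[of N c a] assms by (fastforce simp: of_nat_fact)
  finally show ?thesis .
qed

text \<open>Trinomial revision \<open>(m choose l) (l choose i) = (m choose i) ((m - i) choose (l - i))\<close> and
  \<open>(a)\<^sub>i\<^sub>+\<^sub>s = (a)\<^sub>i (a + i)\<^sub>s\<close> reduce the sum to the preceding one with both parameters shifted by
  \<open>i\<close>, which leaves their difference unchanged.\<close>
lemma alternating_binomial_transform_pochhammer:
  fixes a c :: real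
  assumes c: "c > 0" and i: "i \<le> m"
  shows "(\<Sum>l = i..m. (-1) ^ (l - i) * real (m choose l)
      * (pochhammer a l / pochhammer c l) * real (l choose i))
    = real (m choose i) * pochhammer a i * pochhammer (c - a) (m - i) / pochhammer c m"
proof -
  define C where "C = real (m choose i) * (pochhammer a i / pochhammer c i)"
  have "(\<Sum>l = i..m. (-1) ^ (l - i) * real (m choose l)
      * (pochhammer a l / pochhammer c l) * real (l choose i))
    = (\<Sum>s\<le>m - i. C * ((-1) ^ s * real ((m - i) choose s)
        * (pochhammer (a + i) s / pochhammer (c + i) s)))"
  proof (rule sum.reindex_bij_witness[of _ "\<lambda>s. s + i" "\<lambda>l. l - i"])
    fix l assume l: "l \<in> {i..m}"
    have "real (m choose l) * real (l choose i) = real (m choose i) * real ((m - i) choose (l - i))"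
      using l choose_mult[of i l m] by (simp flip: of_nat_mult)
    moreover have "pochhammer z l = pochhammer z i * pochhammer (z + real i) (l - i)" for z :: real
      using l pochhammer_product[of i l z] by simp
    ultimately show "C * ((-1) ^ (l - i) * real ((m - i) choose (l - i))
          * (pochhammer (a + i) (l - i) / pochhammer (c + i) (l - i)))
        = (-1) ^ (l - i) * real (m choose l) * (pochhammer a l / pochhammer c l) * real (l choose i)"
      by (simp add: C_def field_simps)
  qed (use i in auto)
  also have "\<dots> = C * (pochhammer (c - a) (m - i) / pochhammer (c + i) (m - i))"
    using sum_alternating_binomial_pochhammer_quotient[of "c + i" "m - i" "a + i"] c
    unfolding sum_distrib_left[symmetric] by simp
  also have "\<dots> = real (m choose i) * pochhammer a i * pochhammer (c - a) (m - i) / pochhammer c m"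
    using pochhammer_product[OF i, of c] by (simp add: C_def)
  finally show ?thesis .
qed

section \<open>Rising factorials of one half\<close>

lemma central_binomial_pochhammer:
  "real ((2 * j) choose j) = 4 ^ j * pochhammer (1 / 2) j / fact j"
proof -
  have "real ((2 * j) choose j) = fact (2 * j) / (fact j * fact j)"
    by (simp add: binomial_fact)
  then show ?thesis
    by (simp add: fact_double power_mult)
qed

lemma r_coeff_eq_pochhammer:
  assumes "j \<le> n"
  shows "r_coeff n j = pochhammer (1 / 2) j * pochhammer (1 / 2) (n - j) / fact n"
proof -
  have "(4 :: real) ^ n = 4 ^ j * 4 ^ (n - j)"
    using assms by (simp flip: power_add)
  moreover have "2 * n - 2 * j = 2 * (n - j)"
    by simp
  ultimately show ?thesis
    using assms unfolding r_coeff_def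
    by (simp only: central_binomial_pochhammer)
       (simp add: binomial_fact power_int_minus field_simps)
qed

lemma pochhammer_half_shift:
  "pochhammer (real k + 1 / 2) i = pochhammer (1 / 2) (k + i) / pochhammer (1 / 2) k"
proof -
  have "pochhammer (1 / 2 :: real) k > 0"
    by (intro pochhammer_pos) simp
  then show ?thesis
      using pochhammer_product'[of "1 / 2 :: real" k i] by (simp add: add.commute)
qed

text \<open>In terms of \<open>p = k - 1\<close>, \<open>i\<close> and \<open>q = n - k - i\<close> the arguments of all factorials are sums. Once the
  half-integral rising factorials, the central binomial coefficients inside \<open>r_coeff\<close> and the factorials
  \<open>(2 x)!\<close> are written through \<open>(1/2)\<^sub>x\<close>, the two sides differ only by \<open>(2 k - 1)!\<close> against
  \<open>2 ^ (2 k - 1) (1/2)\<^sub>k (k - 1)!\<close>, and these are equal by the duplication formula.\<close>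
lemma transform_eq_binomial_r_coeff:
  fixes p i q :: nat
  defines "k \<equiv> Suc p" and "n \<equiv> Suc p + i + q"
  shows "real ((i + q) choose i) * pochhammer (real k + 1 / 2) i * pochhammer (real k - 1 / 2) q
      / pochhammer (2 * real k) (i + q)
    = 2 ^ (2 * p + 1) * inverse (real ((n + p) choose p)) * inverse (real ((n - 1) choose p))
      * real ((2 * p + 2 * q) choose (2 * p)) * real ((n - 1) choose i) * r_coeff n (k + i)"
proof -
  define h :: "nat \<Rightarrow> real" where "h = pochhammer (1 / 2)"
  have h_pos: "h x > 0" for x
    unfolding h_def by (intro pochhammer_pos) simp
  have a: "pochhammer (real k + 1 / 2) i = h (k + i) / h k"
    unfolding h_def by (rule pochhammer_half_shift)
  have b: "pochhammer (real k - 1 / 2) q = h (p + q) / h p"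
    using pochhammer_half_shift[of p q] by (simp add: h_def k_def add.commute)
  have c: "pochhammer (2 * real k) (i + q) = fact (n + p) / fact (2 * p + 1)"
  proof -
    have "1 + real (2 * p + 1) = 2 * real k" "2 * p + 1 + (i + q) = n + p"
      by (simp_all add: k_def n_def)
    then have "fact (n + p) = fact (2 * p + 1) * pochhammer (2 * real k) (i + q)"
      unfolding pochhammer_fact by (metis pochhammer_product')
    then show ?thesis
      by (simp del: fact_Suc)
  qed
  have r: "r_coeff n (k + i) = h (k + i) * h q / fact n"
    using r_coeff_eq_pochhammer[of "k + i" n] by (simp add: h_def n_def k_def)
  have even_fact: "fact (2 * x) = 4 ^ x * h x * fact x" for x
    by (simp add: fact_double h_def power_mult)
  have d: "real ((2 * p + 2 * q) choose (2 * p))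
      = h (p + q) * fact (p + q) / (h p * fact p * h q * fact q)"
  proof -
    have "real ((2 * p + 2 * q) choose (2 * p)) = fact (2 * (p + q)) / (fact (2 * p) * fact (2 * q))"
      by (simp add: binomial_fact)
    then show ?thesis
      unfolding even_fact by (simp add: power_add)
  qed
  have unmatched: "fact (2 * p + 1) = 2 ^ (2 * p + 1) * h k * fact p"
  proof -
    have "2 * k = Suc (2 * p + 1)"
      by (simp add: k_def)
    then have "fact (2 * k) = 2 * real k * fact (2 * p + 1)"
      by (metis fact_Suc of_nat_mult of_nat_numeral)
    moreover have "(4 :: real) ^ k = 2 * 2 ^ (2 * p + 1)"
      by (simp add: k_def power_mult)
    moreover have "fact k = real k * fact p"
      by (simp add: k_def)
    ultimately have "2 * real k * fact (2 * p + 1) = 2 * real k * (2 ^ (2 * p + 1) * h k * fact p)"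
      using even_fact[of k] by (simp only: mult_ac)
    moreover have "2 * real k \<noteq> 0"
      by (simp add: k_def)
    ultimately show ?thesis
      by (metis mult_left_cancel)
  qed
  have bin: "real ((i + q) choose i) = fact (i + q) / (fact i * fact q)"
    "real ((n + p) choose p) = fact (n + p) / (fact p * fact n)"
    "real ((n - 1) choose p) = fact (n - 1) / (fact p * fact (i + q))"
    "real ((n - 1) choose i) = fact (n - 1) / (fact i * fact (p + q))"
    by (simp_all add: binomial_fact n_def add_ac)
  show ?thesis
    using h_pos[of k] h_pos[of p] h_pos[of q]
    unfolding a b c d r bin unmatched by (simp add: field_simps)
qed

section \<open>The inverse pair\<close>

theorem mainTheorem11:
  fixes k n :: nat
  assumes "1 \<le> k" and "k \<le> n"
  shows "(\<forall>i\<le>n - k.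
      (\<Sum>l = i..n - k. (-1) ^ (l - i) * real ((n - k) choose l)
          * (pochhammer (real k + 1 / 2) l / pochhammer (2 * real k) l) * real (l choose i))
      = 2 ^ (2 * k - 1) * inverse (real ((n + k - 1) choose (k - 1)))
          * inverse (real ((n - 1) choose (k - 1)))
          * real ((2 * n - 2 * i - 2) choose (2 * k - 2)) * real ((n - 1) choose i)
          * r_coeff n (k + i))
    \<and> (\<forall>j\<le>n - k.
      (\<Sum>l = j..n - k. real ((2 * n - 2 * l - 2) choose (2 * k - 2)) * real ((n - 1) choose l)
          * real (l choose j) * r_coeff n (k + l))
      = 2 powi (1 - 2 * int k) * real ((n + k - 1) choose (k - 1))
          * real ((n - 1) choose (k - 1)) * real ((n - k) choose j)
          * (pochhammer (real k + 1 / 2) j / pochhammer (2 * real k) j))"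
proof -
  define K where "K = 2 ^ (2 * k - 1) * inverse (real ((n + k - 1) choose (k - 1)))
    * inverse (real ((n - 1) choose (k - 1)))"
  define f where "f l = real ((n - k) choose l)
    * (pochhammer (real k + 1 / 2) l / pochhammer (2 * real k) l)" for l
  define u where "u i = real ((2 * n - 2 * i - 2) choose (2 * k - 2)) * real ((n - 1) choose i)
    * r_coeff n (k + i)" for i
  have transform: "K * u i = (\<Sum>l = i..n - k. (-1) ^ (l - i) * f l * real (l choose i))"
    if i: "i \<le> n - k" for i
  proof -
    obtain p where p: "k = Suc p"
      using assms(1) by (cases k) auto
    obtain q where q: "n = Suc p + i + q"
      using i assms(2) p by (metis le_add_diff_inverse add.assoc)
    have "2 * n - 2 * i - 2 = 2 * p + 2 * q" "2 * k - 2 = 2 * p" "n + k - 1 = n + p"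
      "2 * k - 1 = 2 * p + 1" "n - k = i + q" "k - 1 = p"
      by (simp_all add: p q)
    moreover have "2 * real k - (real k + 1 / 2) = real k - 1 / 2"
      by simp
    ultimately show ?thesis
      using alternating_binomial_transform_pochhammer[of "2 * real k" i "n - k" "real k + 1 / 2"]
        transform_eq_binomial_r_coeff[of i q p] i assms(1)
      by (simp add: K_def u_def f_def p q mult.assoc)
  qed
  have inverse_transform: "(\<Sum>l = j..n - k. u l * real (l choose j)) = inverse K * f j"
    if j: "j \<le> n - k" for j
  proof -
    have "K > 0"
      using assms by (simp add: K_def)
    moreover have "K * (\<Sum>l = j..n - k. u l * real (l choose j)) = f j"
      using binomial_inversion[OF transform j] by (simp add: sum_distrib_left mult.assoc)
    ultimately show ?thesis
      by (simp add: field_simps)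
  qed
  have "2 powi (1 - 2 * int k) = inverse ((2 :: real) ^ (2 * k - 1))"
  proof -
    have "1 - 2 * int k = - int (2 * k - 1)"
      using assms(1) by (simp add: of_nat_diff)
    then show ?thesis
      by (simp only: power_int_minus power_int_of_nat)
  qed
  then have K_inverse: "inverse K = 2 powi (1 - 2 * int k) * real ((n + k - 1) choose (k - 1))
      * real ((n - 1) choose (k - 1))"
    by (simp add: K_def)
  show ?thesis
  proof (intro conjI allI impI)
    fix i assume "i \<le> n - k"
    from transform[OF this] show "(\<Sum>l = i..n - k. (-1) ^ (l - i) * real ((n - k) choose l)
          * (pochhammer (real k + 1 / 2) l / pochhammer (2 * real k) l) * real (l choose i))
      = 2 ^ (2 * k - 1) * inverse (real ((n + k - 1) choose (k - 1)))
          * inverse (real ((n - 1) choose (k - 1)))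
          * real ((2 * n - 2 * i - 2) choose (2 * k - 2)) * real ((n - 1) choose i)
          * r_coeff n (k + i)"
      by (simp only: K_def f_def u_def mult.assoc)
  next
    fix j assume "j \<le> n - k"
    from inverse_transform[OF this]
    have "(\<Sum>l = j..n - k. real ((2 * n - 2 * l - 2) choose (2 * k - 2)) * real ((n - 1) choose l)
        * real (l choose j) * r_coeff n (k + l)) = inverse K * f j"
      by (simp only: u_def mult.assoc mult.commute[of "r_coeff _ _"])
    then show "(\<Sum>l = j..n - k. real ((2 * n - 2 * l - 2) choose (2 * k - 2)) * real ((n - 1) choose l)
          * real (l choose j) * r_coeff n (k + l))
      = 2 powi (1 - 2 * int k) * real ((n + k - 1) choose (k - 1))
          * real ((n - 1) choose (k - 1)) * real ((n - k) choose j)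
          * (pochhammer (real k + 1 / 2) j / pochhammer (2 * real k) j)"
      by (simp only: K_inverse f_def mult.assoc)
  qed
qed

end
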